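(* Let $A=A^\top\in\mathbb{R}^{3\times3}$ be such that $\bar A=\frac12(\mathrm{tr}(A)I-A)$ is positive definite. Let $\epsilon,\gamma>0$ be such that $\gamma<[1+\epsilon]^{-1/2}$, and put $\xi_0=1-\gamma^2\epsilon/(1-\gamma^2)$. Consider the attitude kinematics $\dot R=R[\omega]_\times$ on $SO(3)$, with angular velocity $\omega(t)\in\mathbb{R}^3$, coupled with the attitude observer (with error-free measurements) $$\dot{\hat R}=\hat R[\omega]_\times-[\sigma_{k_2}]_\times\hat R,\qquad \sigma_{k_2}=-k_2(R\hat R^\top)\,\psi(AR\hat R^\top),\qquad \hat R(0)\in SO(3),$$ where $k_2(\tilde R)=[1+\epsilon-|\tilde R|_I^2]^{-1/2}$, and let $\tilde R=R\hat R^\top$. Then, for any $\tilde R(0)\in\mathcal{B}_{\xi_0}=\{\tilde R\in SO(3): |\tilde R|_I^2<\xi_0\}$, one has $$\underline\beta(|\tilde R(0)|_I,t)\le|\tilde R(t)|_I\le\bar\beta(|\tilde R(0)|_I,t),\qquad\forall t\ge0,$$ where $\underline\beta$ and $\bar\beta$ are class $\mathcal{KL}$ functions given by $$\bar\beta(s,t)=\frac{s}{\cosh(\gamma\lambda_{\min}^{\bar A}t)+(1-s^2)^{1/2}\sinh(\gamma\lambda_{\min}^{\bar A}t)},$$ $$\underline\beta(s,t)=\frac{s}{\cosh(\lambda_{\max}^{\bar A}t)+(1-s^2)^{1/2}\sinh(\lambda_{\max}^{\bar A}t)}.$$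
   Context: $SO(3)=\{R\in\mathbb{R}^{3\times3}: \det R=1,\ RR^\top=I\}$. $[x]_\times$ is the skew-symmetric matrix with $[x]_\times y=x\times y$ for $x,y\in\mathbb{R}^3$; $\mathrm{vex}$ is the inverse of $x\mapsto[x]_\times$ on skew-symmetric matrices. For $M\in\mathbb{R}^{3\times3}$, $\psi(M)=\mathrm{vex}\big((M-M^\top)/2\big)$. For $R\in SO(3)$, $|R|_I\in[0,1]$ is defined by $|R|_I^2=\frac14\mathrm{tr}(I-R)$. $\lambda_{\min}^{\bar A}$ and $\lambda_{\max}^{\bar A}$ are the minimum and maximum eigenvalues of $\bar A$. Class $\mathcal{KL}$ (here with first argument $s\in[0,1]$, the range of $|\cdot|_I$, and $t\ge0$): continuous, for each fixed $t$ strictly increasing in $s$ and vanishing at $s=0$, and for each fixed $s$ nonincreasing in $t$ and tending to $0$ as $t\to\infty$. *)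

theory Defs
  imports "HOL-Analysis.Analysis"
begin

unbundle no cross3_syntax
unbundle set_product_syntax

definition SO3 :: "(real^3^3) set" where
  "SO3 = {R. det R = 1 \<and> R ** transpose R = mat 1}"

definition skew :: "real^3 \<Rightarrow> real^3^3" where
  "skew x = matrix (cross3 x)"

lemma skew_mult_vec: "skew x *v y = cross3 x y"
proof -
  have "linear (cross3 x)"
    by (intro linearI cross_add_right cross_mult_right)
  then show ?thesis
    by (simp add: skew_def matrix_works)
qed

lemma inj_skew: "inj skew"
proof (rule injI)
  fix x y assume "skew x = skew y"
  then show "x = y"
    by (simp add: skew_def matrix_def cross3_def vec_eq_iff forall_3 vector_3 axis_def)
qed

text \<open>Only the values on skew-symmetric matrices, i.e. on the range of \<^term>\<open>skew\<close>, are meaningful.\<close>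

definition vex :: "real^3^3 \<Rightarrow> real^3" where
  "vex = inv skew"

lemma vex_skew: "vex (skew x) = x"
  by (simp add: vex_def inj_skew)

lemma skew_vex:
  assumes "transpose M = - M"
  shows "skew (vex M) = M"
proof -
  have tr: "M $ i $ j = - (M $ j $ i)" for i j
    using arg_cong[OF assms, of "\<lambda>N. N $ j $ i"] by (simp add: transpose_def)
  have diag: "M $ i $ i = 0" for i
    using tr[of i i] by simp
  have "M = skew (vector [M $ 3 $ 2, M $ 1 $ 3, M $ 2 $ 1])"
    using tr[of 2 3] tr[of 3 1] tr[of 1 2]
    by (simp add: skew_def matrix_def cross3_def vec_eq_iff forall_3 vector_3 axis_def diag)
  then have "M \<in> range skew"
    by blast
  then show ?thesis
    by (simp add: vex_def f_inv_into_f)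
qed

definition psi :: "real^3^3 \<Rightarrow> real^3" where
  "psi M = vex ((1/2) *\<^sub>R (M - transpose M))"

definition att_norm :: "real^3^3 \<Rightarrow> real" where
  "att_norm R = sqrt (1/4 * trace (mat 1 - R))"

definition att_ball :: "real \<Rightarrow> (real^3^3) set" where
  "att_ball \<xi> = {R \<in> SO3. (att_norm R)\<^sup>2 < \<xi>}"

definition bar :: "real^3^3 \<Rightarrow> real^3^3" where
  "bar A = (1/2) *\<^sub>R (trace A *\<^sub>R mat 1 - A)"

definition pos_def :: "real^'n^'n \<Rightarrow> bool" where
  "pos_def M \<longleftrightarrow> transpose M = M \<and> (\<forall>x. x \<noteq> 0 \<longrightarrow> x \<bullet> (M *v x) > 0)"

definition eigvals :: "real^'n^'n \<Rightarrow> real set" where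
  "eigvals M = {l. \<exists>v. v \<noteq> 0 \<and> M *v v = l *\<^sub>R v}"

text \<open>The extremal eigenvalues are meant for symmetric matrices, whose set of real eigenvalues is
  finite and nonempty; \<^const>\<open>Min\<close> and \<^const>\<open>Max\<close> are unspecified otherwise.\<close>

definition lambda_min :: "real^'n^'n \<Rightarrow> real" where
  "lambda_min M = Min (eigvals M)"

definition lambda_max :: "real^'n^'n \<Rightarrow> real" where
  "lambda_max M = Max (eigvals M)"

definition k2 :: "real \<Rightarrow> real^3^3 \<Rightarrow> real" where
  "k2 \<epsilon> Rt = (1 + \<epsilon> - (att_norm Rt)\<^sup>2) powr (-1/2)"

definition sigma_k2 :: "real^3^3 \<Rightarrow> real \<Rightarrow> real^3^3 \<Rightarrow> real^3^3 \<Rightarrow> real^3" where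
  "sigma_k2 A \<epsilon> R Rh =
     - k2 \<epsilon> (R ** transpose Rh) *\<^sub>R psi (A ** R ** transpose Rh)"

definition attitude_kinematics :: "(real \<Rightarrow> real^3) \<Rightarrow> (real \<Rightarrow> real^3^3) \<Rightarrow> bool" where
  "attitude_kinematics \<omega> R \<longleftrightarrow>
     (\<forall>t\<ge>0. R t \<in> SO3 \<and>
        (R has_vector_derivative R t ** skew (\<omega> t)) (at t within {0..}))"

text \<open>Only the initial value is required to lie in \<^term>\<open>SO3\<close>; that the estimate remains
  there is a consequence of the differential equation.\<close>

definition attitude_observer ::
  "real^3^3 \<Rightarrow> real \<Rightarrow> (real \<Rightarrow> real^3) \<Rightarrow> (real \<Rightarrow> real^3^3) \<Rightarrow> (real \<Rightarrow> real^3^3) \<Rightarrow> bool" where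
  "attitude_observer A \<epsilon> \<omega> R Rh \<longleftrightarrow>
     Rh 0 \<in> SO3 \<and>
     (\<forall>t\<ge>0. (Rh has_vector_derivative
        (Rh t ** skew (\<omega> t) - skew (sigma_k2 A \<epsilon> (R t) (Rh t)) ** Rh t)) (at t within {0..}))"

text \<open>The first argument is restricted to \<open>[0, 1]\<close>, the range of \<^const>\<open>att_norm\<close> on \<^const>\<open>SO3\<close>.\<close>

definition class_KL :: "(real \<Rightarrow> real \<Rightarrow> real) \<Rightarrow> bool" where
  "class_KL \<beta> \<longleftrightarrow>
     continuous_on ({0..1} \<times> {0..}) (\<lambda>(s, t). \<beta> s t) \<and>
     (\<forall>t\<ge>0. strict_mono_on {0..1} (\<lambda>s. \<beta> s t) \<and> \<beta> 0 t = 0) \<and>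
     (\<forall>s\<in>{0..1}. antimono_on {0..} (\<beta> s) \<and> (\<beta> s \<longlongrightarrow> 0) at_top)"

definition beta_upper :: "real \<Rightarrow> real^3^3 \<Rightarrow> real \<Rightarrow> real \<Rightarrow> real" where
  "beta_upper \<gamma> A s t =
     s / (cosh (\<gamma> * lambda_min (bar A) * t)
          + sqrt (1 - s\<^sup>2) * sinh (\<gamma> * lambda_min (bar A) * t))"

definition beta_lower :: "real^3^3 \<Rightarrow> real \<Rightarrow> real \<Rightarrow> real" where
  "beta_lower A s t =
     s / (cosh (lambda_max (bar A) * t)
          + sqrt (1 - s\<^sup>2) * sinh (lambda_max (bar A) * t))"

end

theory Submission
  imports Defs
begin

text \<open>Write \<open>Q\<close> for the attitude error \<open>R R\<^sub>h\<^sup>T\<close> and \<open>V\<close> for the square of its norm. The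
  angular velocity cancels in the error dynamics, which read \<open>Q' = Q [\<sigma>]\<^sub>\<times>\<close>
  (\<open>attitude_error_derivative\<close>). Since the right factor is skew, \<open>Q Q\<^sup>T\<close> is constant,
  so \<open>Q\<close> stays a rotation (\<open>SO3_invariant\<close>).

  On rotations everything reduces to the single vector \<open>p = \<psi>(Q)\<close>. Two identities do this:
  \<open>p \<bullet> \<psi>(A Q) = p \<bullet> (bar A) p\<close> (\<open>inner_psi_weighted\<close>) uses orthogonality alone, and
  \<open>p \<bullet> p = 4 V (1 - V)\<close> (\<open>inner_psi_self\<close>) also uses that the determinant is one.
  Hence \<open>V' = - (k\<^sub>2 / 2) (p \<bullet> (bar A) p)\<close>, and the Rayleigh bounds for the symmetric matrix
  \<open>bar A\<close> put \<open>V'\<close> between \<open>- 2 \<lambda>\<^sub>m\<^sub>a\<^sub>x V k\<^sub>2 (1 - V)\<close> and \<open>- 2 \<lambda>\<^sub>m\<^sub>i\<^sub>n V k\<^sub>2 (1 - V)\<close>.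
  The gain is designed so that \<open>k\<^sub>2 (1 - V) \<le> sqrt (1 - V)\<close> always holds, and
  \<open>\<gamma> sqrt (1 - V) \<le> k\<^sub>2 (1 - V)\<close> holds exactly as long as \<open>V \<le> \<xi>\<^sub>0\<close>. The latter set is
  forward invariant because \<open>V\<close> does not increase.

  It remains to compare with the scalar equation \<open>V' = - 2 a V sqrt (1 - V)\<close>. The substitution
  \<open>sqrt V = sech y\<close>, that is \<open>y = arcosh (1 / sqrt V)\<close>, turns it into \<open>y' = a\<close>; so
  \<open>y\<close> grows at a rate between \<open>\<gamma> \<lambda>\<^sub>m\<^sub>i\<^sub>n\<close> and \<open>\<lambda>\<^sub>m\<^sub>a\<^sub>x\<close>, and the addition formula for
  \<open>cosh\<close> gives the two envelopes. The substitution needs \<open>V > 0\<close>, which persists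
  because \<open>V' \<ge> - 2 \<lambda>\<^sub>m\<^sub>a\<^sub>x V\<close>; if \<open>V\<close> starts at zero, it stays there.\<close>

section \<open>Extremal eigenvalues of a symmetric matrix\<close>

lemma inner_matrix_symmetric:
  fixes M :: "real^'n^'n"
  assumes "transpose M = M"
  shows "x \<bullet> (M *v y) = (M *v x) \<bullet> y"
  by (metis assms dot_lmul_matrix transpose_matrix_vector)

lemma orthogonal_eigenvectors:
  fixes M :: "real^'n^'n"
  assumes "transpose M = M" "M *v x = a *\<^sub>R x" "M *v y = b *\<^sub>R y" "a \<noteq> b"
  shows "x \<bullet> y = 0"
  using inner_matrix_symmetric[OF assms(1), of x y] assms(2-4) by simp

text \<open>Eigenvectors of distinct eigenvalues are orthogonal, hence independent, so there are no more
  eigenvalues than dimensions. Finiteness is what makes \<^const>\<open>Min\<close> and \<^const>\<open>Max\<close> of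
  the eigenvalues meaningful.\<close>

lemma finite_eigvals:
  fixes M :: "real^'n^'n"
  assumes sym: "transpose M = M"
  shows "finite (eigvals M)"
proof -
  define v where "v l = (SOME x. x \<noteq> 0 \<and> M *v x = l *\<^sub>R x)" for l
  have v: "v l \<noteq> 0 \<and> M *v v l = l *\<^sub>R v l" if "l \<in> eigvals M" for l
    using that someI_ex[of "\<lambda>x. x \<noteq> 0 \<and> M *v x = l *\<^sub>R x"]
    unfolding v_def eigvals_def by blast
  have orth: "v a \<bullet> v b = 0" if "a \<in> eigvals M" "b \<in> eigvals M" "a \<noteq> b" for a b
    using orthogonal_eigenvectors[OF sym] v that by blast
  have inj: "inj_on v (eigvals M)"
    by (rule inj_onI) (metis inner_eq_zero_iff orth v)
  have "pairwise orthogonal (v ` eigvals M)"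
    unfolding pairwise_def orthogonal_def using orth by blast
  moreover have "0 \<notin> v ` eigvals M"
    using v by force
  ultimately have "finite (v ` eigvals M)"
    using pairwise_orthogonal_independent independent_imp_finite by blast
  then show ?thesis
    using inj finite_imageD by blast
qed

text \<open>First-order optimality: the quadratic form attains its minimum \<open>0\<close> at \<open>v\<close>, so its gradient
  \<open>2 M v\<close> vanishes there. Otherwise a short step against the gradient would make the form
  negative.\<close>

lemma psd_null_vector:
  fixes M :: "real^'n^'n"
  assumes sym: "transpose M = M" and psd: "\<And>x. x \<bullet> (M *v x) \<ge> 0"
    and null: "v \<bullet> (M *v v) = 0"
  shows "M *v v = 0"
proof (rule ccontr)
  assume nz: "M *v v \<noteq> 0"
  define w where "w = M *v v"
  define c where "c = w \<bullet> (M *v w)"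
  have pos: "w \<bullet> w > 0" "c \<ge> 0"
    using nz psd by (auto simp: w_def c_def)
  have q: "(v - t *\<^sub>R w) \<bullet> (M *v (v - t *\<^sub>R w)) = t * (t * c - 2 * (w \<bullet> w))" for t
    using null inner_matrix_symmetric[OF sym, of v w]
    by (simp add: matrix_vector_mult_diff_distrib matrix_vector_mult_scaleR inner_diff_left
        inner_diff_right c_def flip: w_def) (simp add: algebra_simps)
  \<comment> \<open>The quadratic in \<open>t\<close> is negative just right of \<open>0\<close>; the summand \<open>1\<close> avoids division by zero.\<close>
  define t where "t = (w \<bullet> w) / (c + 1)"
  have "t > 0" using pos by (simp add: t_def)
  moreover have "t * c \<le> w \<bullet> w"
    using pos by (simp add: t_def field_simps)
  ultimately have "t * (t * c - 2 * (w \<bullet> w)) < 0"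
    using pos(1) by (intro mult_pos_neg) linarith+
  then show False
    using psd[of "v - t *\<^sub>R w"] q[of t] by simp
qed

text \<open>The Rayleigh quotient attains its minimum \<open>m\<close> on the compact unit sphere, and
  \<open>psd_null_vector\<close> applied to \<open>M - m I\<close> shows that a minimizer is an eigenvector.\<close>

lemma Rayleigh_minimum_eigval:
  fixes M :: "real^'n^'n"
  assumes sym: "transpose M = M"
  obtains m where "m \<in> eigvals M" "\<And>x. m * (x \<bullet> x) \<le> x \<bullet> (M *v x)"
proof -
  have "continuous_on (sphere 0 1) (\<lambda>x. x \<bullet> (M *v x))"
    by (intro continuous_intros linear_continuous_on matrix_vector_mul_bounded_linear)
  moreover have "sphere (0 :: real^'n) 1 \<noteq> {}"
    by simp
  ultimately obtain v where v: "norm v = 1"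
    and min: "\<And>x. norm x = 1 \<Longrightarrow> v \<bullet> (M *v v) \<le> x \<bullet> (M *v x)"
    using continuous_attains_inf[OF compact_sphere[of 0 1]] by force
  define m where "m = v \<bullet> (M *v v)"
  have bound: "m * (x \<bullet> x) \<le> x \<bullet> (M *v x)" for x
  proof (cases "x = 0")
    case False
    have "m \<le> (x /\<^sub>R norm x) \<bullet> (M *v (x /\<^sub>R norm x))"
      unfolding m_def by (rule min) (use False in simp)
    also have "\<dots> = (x \<bullet> (M *v x)) / (x \<bullet> x)"
      by (simp add: matrix_vector_mult_scaleR dot_square_norm power2_eq_square field_simps)
    finally show ?thesis
      using False by (simp add: field_simps)
  qed simp
  let ?N = "M - m *\<^sub>R mat 1"
  have N: "?N *v x = M *v x - m *\<^sub>R x" for x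
    by (simp add: matrix_vector_mult_diff_rdistrib flip: scaleR_matrix_vector_assoc)
  have "?N *v v = 0"
  proof (rule psd_null_vector)
    show "transpose ?N = ?N"
      using sym by (simp add: transpose_def vec_eq_iff mat_def)
    show "x \<bullet> (?N *v x) \<ge> 0" for x
      using bound[of x] by (simp add: N inner_diff_right)
    show "v \<bullet> (?N *v v) = 0"
      using v by (simp add: N inner_diff_right dot_square_norm flip: m_def)
  qed
  then have "m \<in> eigvals M"
    using v by (auto simp: N eigvals_def intro!: exI[of _ v])
  with bound that show ?thesis by blast
qed

lemma eigvals_uminus: "l \<in> eigvals (- M) \<longleftrightarrow> - l \<in> eigvals M" for M :: "real^'n^'n"
proof -
  have "(- M) *v v = - (M *v v)" for v
    using matrix_vector_mult_diff_rdistrib[of 0 M v] by simp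
  then show ?thesis
    by (auto simp: eigvals_def minus_equation_iff) (metis minus_minus)+
qed

lemma lambda_min_in_eigvals:
  fixes M :: "real^'n^'n"
  assumes "transpose M = M"
  shows "lambda_min M \<in> eigvals M"
  unfolding lambda_min_def
  by (metis Min_in Rayleigh_minimum_eigval assms empty_iff finite_eigvals)

lemma lambda_min_le_Rayleigh:
  fixes M :: "real^'n^'n"
  assumes "transpose M = M"
  shows "lambda_min M * (x \<bullet> x) \<le> x \<bullet> (M *v x)"
proof -
  obtain m where m: "m \<in> eigvals M" "m * (x \<bullet> x) \<le> x \<bullet> (M *v x)"
    using Rayleigh_minimum_eigval[OF assms] by metis
  then have "lambda_min M \<le> m"
    unfolding lambda_min_def by (simp add: finite_eigvals[OF assms])
  then show ?thesis
    using m(2) by (meson inner_ge_zero mult_right_mono order_trans)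
qed

text \<open>The minimum principle for \<open>- M\<close>, whose spectrum is reflected.\<close>

lemma Rayleigh_le_lambda_max:
  fixes M :: "real^'n^'n"
  assumes "transpose M = M"
  shows "x \<bullet> (M *v x) \<le> lambda_max M * (x \<bullet> x)"
proof -
  have "transpose (- M) = - M"
    using assms by (simp add: transpose_def vec_eq_iff)
  then obtain m where "m \<in> eigvals (- M)" and m: "m * (x \<bullet> x) \<le> x \<bullet> ((- M) *v x)"
    using Rayleigh_minimum_eigval by metis
  then have "- m \<le> lambda_max M"
    unfolding lambda_max_def by (simp add: finite_eigvals[OF assms] eigvals_uminus)
  then have "- m * (x \<bullet> x) \<le> lambda_max M * (x \<bullet> x)"
    by (intro mult_right_mono) auto
  then show ?thesis
    using m matrix_vector_mult_diff_rdistrib[of 0 M x] by simp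
qed

lemma pos_def_lambda_bounds:
  fixes M :: "real^'n^'n"
  assumes "pos_def M"
  shows "0 < lambda_min M" "lambda_min M \<le> lambda_max M"
proof -
  have sym: "transpose M = M"
    using assms by (simp add: pos_def_def)
  obtain v where v: "v \<noteq> 0" "M *v v = lambda_min M *\<^sub>R v"
    using lambda_min_in_eigvals[OF sym] by (auto simp: eigvals_def)
  then have "0 < lambda_min M * (v \<bullet> v)"
    using assms by (metis inner_scaleR_right pos_def_def)
  then show "0 < lambda_min M"
    by (meson inner_ge_zero not_less zero_less_mult_iff)
  show "lambda_min M \<le> lambda_max M"
    using lambda_min_in_eigvals[OF sym] by (simp add: lambda_max_def finite_eigvals[OF sym])
qed

section \<open>The scalar comparison flow\<close>

text \<open>The solution at time \<open>t\<close> of \<open>x' = - a x sqrt (1 - x\<^sup>2)\<close> with \<open>x(0) = s\<close>. Both envelopes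
  are instances of it, for different rates \<open>a\<close>.\<close>

definition sech_flow :: "real \<Rightarrow> real \<Rightarrow> real \<Rightarrow> real" where
  "sech_flow a s t = s / (cosh (a * t) + sqrt (1 - s\<^sup>2) * sinh (a * t))"

text \<open>In the coordinate \<open>y = arcosh (1 / x)\<close> the flow is translation by \<open>a t\<close>: with
  \<open>cosh y = 1 / s\<close> and \<open>sinh y = sqrt (1 - s\<^sup>2) / s\<close>, the denominator of the flow is the
  addition formula for \<open>cosh (y + a t)\<close>, up to the factor \<open>s\<close>.\<close>

lemma sech_flow_eq_sech:
  assumes "0 < s" "s \<le> 1"
  shows "sech_flow a s t = 1 / cosh (arcosh (1 / s) + a * t)"
proof -
  have "sqrt ((1 / s)\<^sup>2 - 1) = sqrt ((1 - s\<^sup>2) / s\<^sup>2)"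
    using assms by (simp add: field_simps)
  also have "\<dots> = sqrt (1 - s\<^sup>2) / s"
    using assms by (simp add: real_sqrt_divide)
  finally have "cosh (arcosh (1 / s) + a * t) = (cosh (a * t) + sqrt (1 - s\<^sup>2) * sinh (a * t)) / s"
    using assms by (simp add: cosh_add sinh_arcosh_real field_simps)
  then show ?thesis
    by (simp add: sech_flow_def)
qed

lemma sech_flow_denominator_ge_cosh:
  assumes "0 \<le> a" "0 \<le> t" "s \<in> {0..1}"
  shows "cosh (a * t) \<le> cosh (a * t) + sqrt (1 - s\<^sup>2) * sinh (a * t)"
  using assms by (simp add: power_le_one)

text \<open>The denominator is at least \<open>cosh (a t)\<close>, does not increase in \<open>s\<close> and does not decrease in
  \<open>t\<close>; the first of these facts gives continuity and the decay to zero.\<close>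

lemma class_KL_sech_flow:
  assumes a: "0 < a"
  shows "class_KL (sech_flow a)"
proof -
  let ?d = "\<lambda>s t. cosh (a * t) + sqrt (1 - s\<^sup>2) * sinh (a * t)"
  have pos: "?d s t > 0" if "s \<in> {0..1}" "t \<ge> 0" for s t
    using sech_flow_denominator_ge_cosh[of a t s] a that cosh_real_pos[of "a * t"] by linarith
  have "continuous_on ({0..1} \<times> {0..}) (\<lambda>z. fst z / ?d (fst z) (snd z))"
    using pos by (intro continuous_intros) force
  then have cont: "continuous_on ({0..1} \<times> {0..}) (\<lambda>(s, t). sech_flow a s t)"
    by (simp add: sech_flow_def case_prod_unfold)
  have mono: "strict_mono_on {0..1} (\<lambda>s. sech_flow a s t)" if t: "t \<ge> 0" for t
  proof (rule strict_mono_onI)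
    fix r s :: real
    assume rs: "r \<in> {0..1}" "s \<in> {0..1}" "r < s"
    have "?d s t \<le> ?d r t"
      using rs a t by (intro add_left_mono mult_right_mono real_sqrt_le_mono diff_left_mono
          power_mono) auto
    then have "r / ?d r t \<le> r / ?d s t"
      using rs pos[OF rs(2) t] pos[OF rs(1) t] by (intro divide_left_mono) auto
    also have "\<dots> < s / ?d s t"
      using rs pos[OF rs(2) t] by (simp add: divide_strict_right_mono)
    finally show "sech_flow a r t < sech_flow a s t"
      by (simp add: sech_flow_def)
  qed
  have anti: "antimono_on {0..} (sech_flow a s)" if s: "s \<in> {0..1}" for s
  proof (rule monotone_onI)
    fix t u :: real
    assume tu: "t \<in> {0..}" "u \<in> {0..}" "t \<le> u"
    have le: "a * t \<le> a * u" and "0 \<le> a * t" using a tu by auto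
    then have "?d s t \<le> ?d s u"
      using s by (intro add_mono mult_left_mono) (auto simp: cosh_real_nonneg_le_iff power_le_one)
    then show "sech_flow a s t \<ge> sech_flow a s u"
      using s tu pos[OF s, of t] pos[OF s, of u]
      unfolding sech_flow_def by (intro divide_left_mono) auto
  qed
  have lim: "(sech_flow a s \<longlongrightarrow> 0) at_top" if s: "s \<in> {0..1}" for s
  proof (rule tendsto_sandwich)
    show "\<forall>\<^sub>F t in at_top. 0 \<le> sech_flow a s t"
      using eventually_ge_at_top[of 0]
      by eventually_elim (use s pos[OF s] in \<open>force simp: sech_flow_def intro: divide_nonneg_pos\<close>)
    show "\<forall>\<^sub>F t in at_top. sech_flow a s t \<le> 1 / cosh (a * t)"
      using eventually_ge_at_top[of 0]
    proof eventually_elim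
      case (elim t)
      show ?case
        unfolding sech_flow_def
        using s elim a sech_flow_denominator_ge_cosh[of a t s] cosh_real_pos[of "a * t"]
        by (intro frac_le) auto
    qed
    have "filterlim (\<lambda>t. cosh (a * t)) at_top at_top"
      by (rule filterlim_compose[OF cosh_real_at_top])
        (rule filterlim_tendsto_pos_mult_at_top[OF tendsto_const a filterlim_ident])
    then show "((\<lambda>t. 1 / cosh (a * t)) \<longlongrightarrow> 0) at_top"
      by (intro tendsto_divide_0[OF tendsto_const] filterlim_at_top_imp_at_infinity)
  qed simp
  have "sech_flow a 0 t = 0" for t
    by (simp add: sech_flow_def)
  with cont mono anti lim show ?thesis
    by (simp add: class_KL_def)
qed

text \<open>Stated for the derivative within the half-line, since the trajectories are only one-sided
  differentiable at the initial time.\<close>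

lemma nonneg_derivative_imp_initial_le:
  fixes f :: "real \<Rightarrow> real"
  assumes D: "\<And>t. t \<ge> 0 \<Longrightarrow> (f has_real_derivative f' t) (at t within {0..})"
    and nonneg: "\<And>t. t \<ge> 0 \<Longrightarrow> f' t \<ge> 0" and t: "t \<ge> 0"
  shows "f 0 \<le> f t"
proof -
  have "\<exists>x\<in>{0..t}. f t - f 0 = f' x * (t - 0)"
  proof (rule mvt_very_simple[OF t])
    fix x assume "0 \<le> x" "x \<le> t"
    then show "(f has_derivative (*) (f' x)) (at x within {0..t})"
      using D[of x] unfolding has_field_derivative_def
      by (rule_tac has_derivative_subset) auto
  qed
  then obtain x where "x \<in> {0..t}" "f t - f 0 = f' x * t"
    by auto
  moreover from this have "0 \<le> f' x * t"
    using nonneg[of x] t by simp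
  ultimately show ?thesis
    by simp
qed

text \<open>The function \<open>exp (c t) V(t)\<close> does not decrease.\<close>

lemma positive_of_linear_decay_bound:
  fixes V :: "real \<Rightarrow> real"
  assumes D: "\<And>t. t \<ge> 0 \<Longrightarrow> (V has_real_derivative V' t) (at t within {0..})"
    and bound: "\<And>t. t \<ge> 0 \<Longrightarrow> V' t \<ge> - c * V t" and V0: "V 0 > 0" and t: "t \<ge> 0"
  shows "V t > 0"
proof -
  have "exp (c * 0) * V 0 \<le> exp (c * t) * V t"
  proof (rule nonneg_derivative_imp_initial_le[where f' = "\<lambda>t. exp (c * t) * (V' t + c * V t)", OF _ _ t])
    fix t :: real assume t: "t \<ge> 0"
    show "((\<lambda>t. exp (c * t) * V t) has_real_derivative exp (c * t) * (V' t + c * V t))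
        (at t within {0..})"
      by (rule derivative_eq_intros D[OF t] refl)+ (simp add: algebra_simps)
    show "0 \<le> exp (c * t) * (V' t + c * V t)"
      using bound[OF t] by simp
  qed
  then have "0 < exp (c * t) * V t"
    using V0 by simp
  then show ?thesis
    by (simp add: zero_less_mult_iff)
qed

text \<open>The substitution \<open>sqrt V = sech y\<close> straightens the equation
  \<open>V' = - 2 a V sqrt (1 - V)\<close> to \<open>y' = a\<close>.\<close>

lemma arcosh_inverse_sqrt_derivative:
  assumes D: "(V has_real_derivative V') (at t within S)" and V: "0 < V t" "V t < 1"
  shows "((\<lambda>t. arcosh (1 / sqrt (V t))) has_real_derivative - V' / (2 * V t * sqrt (1 - V t)))
    (at t within S)"
proof -
  have gt: "1 < 1 / sqrt (V t)"
    using V by simp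
  have "sqrt ((1 / sqrt (V t))\<^sup>2 - 1) = sqrt ((1 - V t) / V t)"
    using V by (simp add: power_divide field_simps)
  also have "\<dots> = sqrt (1 - V t) / sqrt (V t)"
    by (simp add: real_sqrt_divide)
  finally have root: "sqrt ((1 / sqrt (V t))\<^sup>2 - 1) = sqrt (1 - V t) / sqrt (V t)" .
  have sqrtD: "((\<lambda>t. sqrt (V t)) has_real_derivative V' * (inverse (sqrt (V t)) / 2)) (at t within S)"
    using V by (auto intro!: derivative_eq_intros D)
  have "((\<lambda>t. 1 / sqrt (V t)) has_real_derivative
      - (V' * (inverse (sqrt (V t)) / 2)) / V t) (at t within S)"
    using DERIV_divide[OF DERIV_const[of 1] sqrtD] V by simp
  from DERIV_chain2[OF arcosh_real_has_field_derivative[OF gt] this] show ?thesis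
    unfolding root using V by (simp add: field_simps)
qed

lemma sqrt_eq_sech_arcosh:
  assumes "0 < v" "v < 1"
  shows "sqrt v = 1 / cosh (arcosh (1 / sqrt v))"
  using assms by (simp add: cosh_arcosh_real)

lemma decay_rate_ge_imp_le_sech_flow:
  fixes V :: "real \<Rightarrow> real"
  assumes D: "\<And>t. t \<ge> 0 \<Longrightarrow> (V has_real_derivative V' t) (at t within {0..})"
    and V: "\<And>t. t \<ge> 0 \<Longrightarrow> 0 < V t \<and> V t < 1"
    and rate: "\<And>t. t \<ge> 0 \<Longrightarrow> V' t \<le> - 2 * a * V t * sqrt (1 - V t)"
    and a: "0 \<le> a" and t: "0 \<le> t"
  shows "sqrt (V t) \<le> sech_flow a (sqrt (V 0)) t"
proof -
  define y where "y t = arcosh (1 / sqrt (V t))" for t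
  have y_nonneg: "y t \<ge> 0" if "t \<ge> 0" for t
    using V[OF that] by (simp add: y_def)
  have "y 0 - a * 0 \<le> y t - a * t"
  proof (rule nonneg_derivative_imp_initial_le
      [where f' = "\<lambda>t. - V' t / (2 * V t * sqrt (1 - V t)) - a", OF _ _ t])
    fix t :: real assume t: "t \<ge> 0"
    show "((\<lambda>t. y t - a * t) has_real_derivative - V' t / (2 * V t * sqrt (1 - V t)) - a)
        (at t within {0..})"
      unfolding y_def using V[OF t]
      by (auto intro!: derivative_eq_intros arcosh_inverse_sqrt_derivative D t)
    show "0 \<le> - V' t / (2 * V t * sqrt (1 - V t)) - a"
      using V[OF t] rate[OF t] by (simp add: field_simps)
  qed
  then have "cosh (y 0 + a * t) \<le> cosh (y t)"
    using y_nonneg[OF t] y_nonneg[of 0] a t by (subst cosh_real_nonneg_le_iff) auto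
  then have "1 / cosh (y t) \<le> 1 / cosh (y 0 + a * t)"
    by (simp add: frac_le)
  then show ?thesis
    using V[OF t] V[of 0] sqrt_eq_sech_arcosh[of "V t"]
    by (simp add: sech_flow_eq_sech y_def)
qed

lemma decay_rate_le_imp_ge_sech_flow:
  fixes V :: "real \<Rightarrow> real"
  assumes D: "\<And>t. t \<ge> 0 \<Longrightarrow> (V has_real_derivative V' t) (at t within {0..})"
    and V: "\<And>t. t \<ge> 0 \<Longrightarrow> 0 < V t \<and> V t < 1"
    and rate: "\<And>t. t \<ge> 0 \<Longrightarrow> V' t \<ge> - 2 * a * V t * sqrt (1 - V t)"
    and a: "0 \<le> a" and t: "0 \<le> t"
  shows "sech_flow a (sqrt (V 0)) t \<le> sqrt (V t)"
proof -
  define y where "y t = arcosh (1 / sqrt (V t))" for t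
  have y_nonneg: "y t \<ge> 0" if "t \<ge> 0" for t
    using V[OF that] by (simp add: y_def)
  have "a * 0 - y 0 \<le> a * t - y t"
  proof (rule nonneg_derivative_imp_initial_le
      [where f' = "\<lambda>t. a - - V' t / (2 * V t * sqrt (1 - V t))", OF _ _ t])
    fix t :: real assume t: "t \<ge> 0"
    show "((\<lambda>t. a * t - y t) has_real_derivative a - - V' t / (2 * V t * sqrt (1 - V t)))
        (at t within {0..})"
      unfolding y_def using V[OF t]
      by (auto intro!: derivative_eq_intros arcosh_inverse_sqrt_derivative D t)
    show "0 \<le> a - - V' t / (2 * V t * sqrt (1 - V t))"
      using V[OF t] rate[OF t] by (simp add: field_simps)
  qed
  then have "cosh (y t) \<le> cosh (y 0 + a * t)"
    using y_nonneg[OF t] y_nonneg[of 0] a t by (subst cosh_real_nonneg_le_iff) auto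
  then have "1 / cosh (y 0 + a * t) \<le> 1 / cosh (y t)"
    by (simp add: frac_le)
  then show ?thesis
    using V[OF t] V[of 0] sqrt_eq_sech_arcosh[of "V t"]
    by (simp add: sech_flow_eq_sech y_def)
qed

section \<open>The vector of the skew part of a rotation\<close>

lemma psi_components:
  "psi M = vector [(M $ 3 $ 2 - M $ 2 $ 3) / 2, (M $ 1 $ 3 - M $ 3 $ 1) / 2,
    (M $ 2 $ 1 - M $ 1 $ 2) / 2]" (is "_ = ?p")
proof -
  have "(1/2) *\<^sub>R (M - transpose M) = skew ?p"
    by (simp add: skew_def matrix_def cross3_def vec_eq_iff forall_3 axis_def transpose_def
        field_simps)
  then show ?thesis
    by (simp add: psi_def vex_skew)
qed

lemma inner_psi:
  "psi M \<bullet> psi N = (trace (transpose M ** N) - trace (M ** N)) / 4"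
  by (simp add: psi_components trace_def inner_vec_def sum_3 matrix_matrix_mult_def transpose_def
      field_simps)

lemma trace_mult_skew: "trace (M ** skew s) = - 2 * (psi M \<bullet> s)"
  by (simp add: psi_components trace_def inner_vec_def sum_3 matrix_matrix_mult_def skew_def
      matrix_def cross3_def axis_def field_simps)

lemma transpose_skew: "transpose (skew s) = - skew s"
  by (simp add: skew_def matrix_def cross3_def vec_eq_iff forall_3 axis_def transpose_def)

lemma SO3_left_inverse:
  assumes "R \<in> SO3"
  shows "transpose R ** R = mat 1"
  using assms by (simp add: SO3_def matrix_left_right_inverse)

text \<open>With \<open>S = (M - M\<^sup>T) / 2 = [p]\<^sub>\<times>\<close> one has \<open>S\<^sup>2 = p p\<^sup>T - |p|\<^sup>2 I\<close>, so both sides equal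
  \<open>- tr (A S\<^sup>2) / 2\<close>. For orthogonal \<open>M\<close> the first two traces collapse to \<open>tr A\<close>.\<close>

lemma inner_psi_bar:
  assumes "transpose A = A"
  shows "psi M \<bullet> (bar A *v psi M) =
    (trace (A ** (M ** transpose M)) + trace (A ** (transpose M ** M)) - 2 * trace (A ** (M ** M))) / 8"
proof -
  have "A $ 2 $ 1 = A $ 1 $ 2" "A $ 3 $ 1 = A $ 1 $ 3" "A $ 3 $ 2 = A $ 2 $ 3"
    by (subst (2) assms[symmetric], simp add: transpose_def)+
  then show ?thesis
    by (simp add: psi_components bar_def trace_def inner_vec_def sum_3 matrix_matrix_mult_def
        matrix_vector_mult_def transpose_def mat_def)
      (simp add: field_simps)
qed

text \<open>The weight \<open>A\<close> inside \<open>\<psi>\<close> can be traded for the quadratic form of \<open>bar A\<close> outside: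
  by cyclicity of the trace and orthogonality both sides are \<open>(tr A - tr (A R\<^sup>2)) / 4\<close>.\<close>

lemma inner_psi_weighted:
  assumes R: "R \<in> SO3" and A: "transpose A = A"
  shows "psi R \<bullet> psi (A ** R) = psi R \<bullet> (bar A *v psi R)"
proof -
  have inv: "R ** transpose R = mat 1" "transpose R ** R = mat 1"
    using R SO3_left_inverse by (auto simp: SO3_def)
  have "trace (transpose R ** (A ** R)) = trace A"
    by (simp add: trace_mul_sym[of "transpose R"] inv flip: matrix_mul_assoc)
  moreover have "trace (R ** (A ** R)) = trace (A ** (R ** R))"
    by (subst trace_mul_sym) (simp add: matrix_mul_assoc)
  ultimately show ?thesis
    by (simp add: inner_psi inner_psi_bar[OF A] inv)
qed

text \<open>A rotation equals its own cofactor matrix, because it preserves cross products. These are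
  the diagonal entries of that identity, read off from the images of the basis vectors.\<close>

lemma SO3_principal_minors:
  assumes R: "R \<in> SO3"
  shows "R $ 1 $ 1 * R $ 2 $ 2 - R $ 1 $ 2 * R $ 2 $ 1 = R $ 3 $ 3"
    "R $ 2 $ 2 * R $ 3 $ 3 - R $ 2 $ 3 * R $ 3 $ 2 = R $ 1 $ 1"
    "R $ 3 $ 3 * R $ 1 $ 1 - R $ 3 $ 1 * R $ 1 $ 3 = R $ 2 $ 2"
proof -
  have "rotation_matrix R"
    using R SO3_left_inverse by (auto simp: SO3_def rotation_matrix_def orthogonal_matrix)
  note c = cross_rotation_matrix[OF this]
  show "R $ 1 $ 1 * R $ 2 $ 2 - R $ 1 $ 2 * R $ 2 $ 1 = R $ 3 $ 3"
    using arg_cong[OF c[of "axis 1 1" "axis 2 1"], of "\<lambda>v. v $ 3"]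
    by (simp add: cross3_def matrix_vector_mult_def sum_3 axis_def algebra_simps)
  show "R $ 2 $ 2 * R $ 3 $ 3 - R $ 2 $ 3 * R $ 3 $ 2 = R $ 1 $ 1"
    using arg_cong[OF c[of "axis 2 1" "axis 3 1"], of "\<lambda>v. v $ 1"]
    by (simp add: cross3_def matrix_vector_mult_def sum_3 axis_def algebra_simps)
  show "R $ 3 $ 3 * R $ 1 $ 1 - R $ 3 $ 1 * R $ 1 $ 3 = R $ 2 $ 2"
    using arg_cong[OF c[of "axis 3 1" "axis 1 1"], of "\<lambda>v. v $ 2"]
    by (simp add: cross3_def matrix_vector_mult_def sum_3 axis_def algebra_simps)
qed

lemma SO3_trace_le_3:
  assumes R: "R \<in> SO3"
  shows "trace R \<le> 3"
proof -
  have "R $ i $ i \<le> 1" for i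
  proof -
    have "(R ** transpose R) $ i $ i = 1"
      using R by (simp add: SO3_def mat_def)
    then have "(\<Sum>k\<in>UNIV. (R $ i $ k)\<^sup>2) = 1"
      by (simp add: matrix_matrix_mult_def transpose_def power2_eq_square)
    moreover have "(R $ i $ i)\<^sup>2 \<le> (\<Sum>k\<in>UNIV. (R $ i $ k)\<^sup>2)"
      by (rule member_le_sum) auto
    ultimately show ?thesis
      using power2_le_imp_le[of "R $ i $ i" 1] by simp
  qed
  from this[of 1] this[of 2] this[of 3] show ?thesis
    by (simp add: trace_def sum_3)
qed

lemma att_norm_square:
  assumes "R \<in> SO3"
  shows "(att_norm R)\<^sup>2 = (3 - trace R) / 4"
  using SO3_trace_le_3[OF assms] by (simp add: att_norm_def trace_sub trace_I)

text \<open>In terms of the rotation angle \<open>\<theta>\<close> this says \<open>sin\<^sup>2 \<theta> = 4 sin\<^sup>2 (\<theta>/2) cos\<^sup>2 (\<theta>/2)\<close>. The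
  principal minors of \<open>R\<close> sum to \<open>tr R\<close>, which determines \<open>tr (R\<^sup>2)\<close>.\<close>

lemma inner_psi_self:
  assumes R: "R \<in> SO3"
  shows "psi R \<bullet> psi R = 4 * (att_norm R)\<^sup>2 * (1 - (att_norm R)\<^sup>2)"
proof -
  have "psi R \<bullet> psi R = (3 - trace (R ** R)) / 4"
    by (simp add: inner_psi SO3_left_inverse[OF R] trace_I)
  also have "trace (R ** R) = (trace R)\<^sup>2 - 2 * trace R"
    using SO3_principal_minors[OF R]
    by (simp add: trace_def matrix_matrix_mult_def sum_3 power2_eq_square) (simp add: algebra_simps)
  finally show ?thesis
    unfolding att_norm_square[OF R] by (simp add: field_simps power2_eq_square)
qed

lemma att_norm_range:
  assumes R: "R \<in> SO3"
  shows "0 \<le> att_norm R" "(att_norm R)\<^sup>2 \<le> 1"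
proof -
  show "0 \<le> att_norm R"
    using SO3_trace_le_3[OF R] by (simp add: att_norm_def trace_sub trace_I)
  have "(att_norm R)\<^sup>2 * (1 - (att_norm R)\<^sup>2) \<ge> 0"
    using inner_psi_self[OF R] inner_ge_zero[of "psi R"] by simp
  then show "(att_norm R)\<^sup>2 \<le> 1"
    by (smt (verit) mult_pos_neg)
qed

section \<open>The error dynamics\<close>

lemma bounded_bilinear_matrix_mult:
  "bounded_bilinear ((**) :: real^'m^'n \<Rightarrow> real^'k^'m \<Rightarrow> real^'k^'n)"
proof -
  have "bilinear ((**) :: real^'m^'n \<Rightarrow> real^'k^'m \<Rightarrow> real^'k^'n)"
    unfolding bilinear_def
    by (auto intro!: linearI simp: matrix_matrix_mult_def vec_eq_iff sum.distrib
        sum_distrib_left algebra_simps)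
  then show ?thesis
    by (simp add: bilinear_conv_bounded_bilinear)
qed

lemma has_vector_derivative_transpose:
  fixes F :: "real \<Rightarrow> real^'m^'n"
  assumes "(F has_vector_derivative F') net"
  shows "((\<lambda>t. transpose (F t)) has_vector_derivative transpose F') net"
proof (rule bounded_linear.has_vector_derivative[OF _ assms])
  show "bounded_linear (transpose :: real^'m^'n \<Rightarrow> real^'n^'m)"
    by (intro linear_conv_bounded_linear[THEN iffD1] linearI) (auto simp: transpose_def vec_eq_iff)
qed

lemma has_vector_derivative_trace:
  fixes F :: "real \<Rightarrow> real^'n^'n"
  assumes "(F has_vector_derivative F') net"
  shows "((\<lambda>t. trace (F t)) has_vector_derivative trace F') net"
proof (rule bounded_linear.has_vector_derivative[OF _ assms])
  show "bounded_linear (trace :: real^'n^'n \<Rightarrow> real)"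
    by (intro linear_conv_bounded_linear[THEN iffD1] linearI)
      (auto simp: trace_def sum.distrib sum_distrib_left)
qed

lemma matrix_minus_mult:
  fixes B :: "real^'m^'n" and C :: "real^'k^'m"
  shows "(- B) ** C = - (B ** C)" "B ** (- C) = - (B ** C)"
    "(B - B') ** C = B ** C - B' ** C" "B ** (C - C') = B ** C - B ** C'"
  using bounded_bilinear.minus_left[OF bounded_bilinear_matrix_mult]
    bounded_bilinear.minus_right[OF bounded_bilinear_matrix_mult]
    bounded_bilinear.diff_left[OF bounded_bilinear_matrix_mult]
    bounded_bilinear.diff_right[OF bounded_bilinear_matrix_mult] by blast+

lemma transpose_diff: "transpose (B - C) = transpose B - transpose C" for B C :: "real^'m^'n"
  by (simp add: transpose_def vec_eq_iff)

text \<open>The two terms with the angular velocity cancel since \<open>[\<omega>]\<^sub>\<times>\<close> is skew.\<close>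

lemma attitude_error_derivative:
  fixes R Rh :: "real \<Rightarrow> real^3^3"
  assumes R: "(R has_vector_derivative R t ** skew w) (at t within S)"
    and Rh: "(Rh has_vector_derivative (Rh t ** skew w - skew s ** Rh t)) (at t within S)"
  shows "((\<lambda>t. R t ** transpose (Rh t)) has_vector_derivative
    (R t ** transpose (Rh t)) ** skew s) (at t within S)"
  using bounded_bilinear.has_vector_derivative[OF bounded_bilinear_matrix_mult R
      has_vector_derivative_transpose[OF Rh]]
  by (simp add: transpose_diff matrix_transpose_mul transpose_skew matrix_minus_mult
      matrix_mul_assoc)

text \<open>Skewness makes \<open>Q Q\<^sup>T\<close> constant, whatever the angular velocity \<open>s\<close>. The determinant
  is then \<open>1\<close> or \<open>-1\<close> at each time, and by continuity it cannot jump.\<close>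

lemma SO3_invariant:
  assumes Q0: "Q 0 \<in> SO3"
    and D: "\<And>t. t \<ge> 0 \<Longrightarrow> (Q has_vector_derivative Q t ** skew (s t)) (at t within {0..})"
    and t: "t \<ge> 0"
  shows "Q t \<in> SO3"
proof -
  have "((\<lambda>t. Q t ** transpose (Q t)) has_vector_derivative 0) (at t within {0..})"
    if "t \<in> {0..}" for t
    using bounded_bilinear.has_vector_derivative[OF bounded_bilinear_matrix_mult D
        has_vector_derivative_transpose[OF D], of t] that
    by (simp add: matrix_transpose_mul transpose_skew matrix_minus_mult matrix_mul_assoc)
  then obtain C where "\<And>t. t \<in> {0..} \<Longrightarrow> Q t ** transpose (Q t) = C"
    using has_vector_derivative_zero_constant[OF convex_real_interval(1)] by blast
  then have inv: "Q t ** transpose (Q t) = mat 1" if "t \<ge> 0" for t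
    using that Q0 by (force simp: SO3_def)
  have sq: "det (Q t) * det (Q t) = 1" if "t \<ge> 0" for t
    using arg_cong[OF inv[OF that], of det] by (simp add: det_mul)
  have "det (Q t) = 1"
  proof (rule ccontr)
    assume "det (Q t) \<noteq> 1"
    then have neg: "det (Q t) \<le> 0"
      using sq[OF t] by (smt (verit) mult_less_cancel_left2 mult_less_cancel_right2)
    have "continuous_on {0..} Q"
      by (auto simp: continuous_on_eq_continuous_within intro!: has_vector_derivative_continuous D)
    then have "continuous_on {0..t} Q"
      by (rule continuous_on_subset) auto
    then have "continuous_on {0..t} (\<lambda>t. det (Q t))"
      unfolding det_3 by (intro continuous_intros)
    moreover have "0 \<le> det (Q 0)"
      using Q0 by (simp add: SO3_def)
    ultimately obtain x where "0 \<le> x" "det (Q x) = 0"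
      using IVT2'[of "\<lambda>t. det (Q t)" t 0 0] neg t by auto
    then show False
      using sq[of x] by simp
  qed
  then show ?thesis
    using inv[OF t] by (simp add: SO3_def)
qed

lemma att_norm_square_derivative:
  assumes Q: "\<And>t. t \<ge> 0 \<Longrightarrow> Q t \<in> SO3"
    and D: "(Q has_vector_derivative Q t ** skew s) (at t within {0..})" and t: "t \<ge> 0"
  shows "((\<lambda>t. (att_norm (Q t))\<^sup>2) has_real_derivative (psi (Q t) \<bullet> s) / 2) (at t within {0..})"
proof -
  have "((\<lambda>t. (3 - trace (Q t)) / 4) has_real_derivative (psi (Q t) \<bullet> s) / 2) (at t within {0..})"
    using has_vector_derivative_trace[OF D]
    by (auto simp: trace_mult_skew simp flip: has_real_derivative_iff_has_vector_derivative
        intro!: derivative_eq_intros)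
  then show ?thesis
    by (rule has_field_derivative_transform_within[of _ _ _ _ 1])
      (use t Q in \<open>auto simp: att_norm_square\<close>)
qed

lemma k2_eq: "k2 \<epsilon> Q = 1 / sqrt (1 + \<epsilon> - (att_norm Q)\<^sup>2)" if "Q \<in> SO3" "0 < \<epsilon>"
  using att_norm_range(2)[OF that(1)] that(2)
  by (simp add: k2_def powr_minus powr_half_sqrt inverse_eq_divide)

lemma k2_pos:
  assumes "Q \<in> SO3" "0 < \<epsilon>"
  shows "0 < k2 \<epsilon> Q"
  using att_norm_range(2)[OF assms(1)] assms by (simp add: k2_eq)

text \<open>For \<open>\<epsilon> = 0\<close> and \<open>V < 1\<close> the gain would be \<open>1 / sqrt (1 - V)\<close> and equality would hold; the
  regularization only lowers it.\<close>

lemma k2_mult_le: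
  assumes "Q \<in> SO3" "0 < \<epsilon>"
  shows "k2 \<epsilon> Q * (1 - (att_norm Q)\<^sup>2) \<le> sqrt (1 - (att_norm Q)\<^sup>2)"
proof -
  define u where "u = 1 - (att_norm Q)\<^sup>2"
  have u: "0 \<le> u"
    using att_norm_range(2)[OF assms(1)] by (simp add: u_def)
  have "k2 \<epsilon> Q = 1 / sqrt (u + \<epsilon>)"
    using k2_eq[OF assms] by (simp add: u_def algebra_simps)
  moreover have "sqrt u * sqrt u \<le> sqrt u * sqrt (u + \<epsilon>)"
    using assms(2) u by (intro mult_left_mono) auto
  ultimately have "k2 \<epsilon> Q * u \<le> sqrt u"
    using assms(2) u by (simp add: pos_divide_le_eq)
  then show ?thesis
    by (simp add: u_def)
qed

text \<open>Squared, with \<open>u = 1 - V\<close>, the claim is \<open>\<gamma>\<^sup>2 (u + \<epsilon>) \<le> u\<close>, which is the hypothesis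
  on \<open>V\<close> rearranged: the loss in the gain costs at most the factor \<open>\<gamma>\<close> on this sublevel
  set.\<close>

lemma k2_mult_ge:
  assumes "Q \<in> SO3" "0 < \<epsilon>" "0 < \<gamma>" "\<gamma> < 1"
    and V: "(att_norm Q)\<^sup>2 \<le> 1 - \<gamma>\<^sup>2 * \<epsilon> / (1 - \<gamma>\<^sup>2)"
  shows "\<gamma> * sqrt (1 - (att_norm Q)\<^sup>2) \<le> k2 \<epsilon> Q * (1 - (att_norm Q)\<^sup>2)"
proof -
  define u where "u = 1 - (att_norm Q)\<^sup>2"
  have u: "0 \<le> u"
    using att_norm_range(2)[OF assms(1)] by (simp add: u_def)
  have "\<gamma>\<^sup>2 < 1"
    using assms by (simp add: power2_less_1_iff abs_less_iff)
  then have "\<gamma>\<^sup>2 * (u + \<epsilon>) \<le> u"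
    using V by (simp add: u_def field_simps)
  then have "\<gamma> * sqrt (u + \<epsilon>) \<le> sqrt u"
    using assms(3) by (metis real_sqrt_abs real_sqrt_le_mono real_sqrt_mult abs_of_pos)
  then have "\<gamma> * sqrt (u + \<epsilon>) * sqrt u \<le> sqrt u * sqrt u"
    by (intro mult_right_mono) (auto simp: u)
  moreover have "k2 \<epsilon> Q = 1 / sqrt (u + \<epsilon>)"
    using k2_eq[OF assms(1,2)] by (simp add: u_def algebra_simps)
  ultimately have "\<gamma> * sqrt u \<le> k2 \<epsilon> Q * u"
    using assms(2) u by (simp add: pos_le_divide_eq mult_ac)
  then show ?thesis
    by (simp add: u_def)
qed

text \<open>The time derivative of the squared error norm along the observer, as a function of the
  current error only.\<close>

definition observer_rate :: "real^3^3 \<Rightarrow> real \<Rightarrow> real^3^3 \<Rightarrow> real" where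
  "observer_rate A \<epsilon> Q = - (k2 \<epsilon> Q * (psi Q \<bullet> psi (A ** Q))) / 2"

lemma transpose_bar: "transpose A = A \<Longrightarrow> transpose (bar A) = bar A"
  by (simp add: bar_def transpose_scalar transpose_diff)

lemma observer_rate_ge:
  assumes Q: "Q \<in> SO3" and A: "transpose A = A" and \<epsilon>: "0 < \<epsilon>" and pos: "0 \<le> lambda_max (bar A)"
  shows "- 2 * lambda_max (bar A) * (att_norm Q)\<^sup>2 * sqrt (1 - (att_norm Q)\<^sup>2)
    \<le> observer_rate A \<epsilon> Q"
proof -
  let ?V = "(att_norm Q)\<^sup>2" and ?\<mu> = "lambda_max (bar A)"
  have "k2 \<epsilon> Q * (psi Q \<bullet> psi (A ** Q)) \<le> k2 \<epsilon> Q * (?\<mu> * (4 * ?V * (1 - ?V)))"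
    using Rayleigh_le_lambda_max[OF transpose_bar[OF A], of "psi Q"] k2_pos[OF Q \<epsilon>]
    by (simp add: inner_psi_weighted[OF Q A] inner_psi_self[OF Q])
  also have "\<dots> = 4 * ?\<mu> * ?V * (k2 \<epsilon> Q * (1 - ?V))"
    by simp
  also have "\<dots> \<le> 4 * ?\<mu> * ?V * sqrt (1 - ?V)"
    using k2_mult_le[OF Q \<epsilon>] pos by (intro mult_left_mono) auto
  finally show ?thesis
    by (simp add: observer_rate_def)
qed

lemma observer_rate_le:
  assumes Q: "Q \<in> SO3" and A: "transpose A = A" and \<epsilon>: "0 < \<epsilon>" and pos: "0 \<le> lambda_min (bar A)"
    and \<gamma>: "0 < \<gamma>" "\<gamma> < 1" and V: "(att_norm Q)\<^sup>2 \<le> 1 - \<gamma>\<^sup>2 * \<epsilon> / (1 - \<gamma>\<^sup>2)"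
  shows "observer_rate A \<epsilon> Q
    \<le> - 2 * (\<gamma> * lambda_min (bar A)) * (att_norm Q)\<^sup>2 * sqrt (1 - (att_norm Q)\<^sup>2)"
proof -
  let ?V = "(att_norm Q)\<^sup>2" and ?\<mu> = "lambda_min (bar A)"
  have "4 * ?\<mu> * ?V * (\<gamma> * sqrt (1 - ?V)) \<le> 4 * ?\<mu> * ?V * (k2 \<epsilon> Q * (1 - ?V))"
    using k2_mult_ge[OF Q \<epsilon> \<gamma> V] pos by (intro mult_left_mono) auto
  also have "\<dots> = k2 \<epsilon> Q * (?\<mu> * (4 * ?V * (1 - ?V)))"
    by simp
  also have "\<dots> \<le> k2 \<epsilon> Q * (psi Q \<bullet> psi (A ** Q))"
    using lambda_min_le_Rayleigh[OF transpose_bar[OF A], of "psi Q"] k2_pos[OF Q \<epsilon>]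
    by (simp add: inner_psi_weighted[OF Q A] inner_psi_self[OF Q])
  finally show ?thesis
    by (simp add: observer_rate_def algebra_simps)
qed

lemma observer_rate_nonpos:
  assumes Q: "Q \<in> SO3" and A: "transpose A = A" and \<epsilon>: "0 < \<epsilon>" and pos: "pos_def (bar A)"
  shows "observer_rate A \<epsilon> Q \<le> 0"
proof -
  have "0 \<le> psi Q \<bullet> psi (A ** Q)"
    using pos by (cases "psi Q = 0") (auto simp: inner_psi_weighted[OF Q A] pos_def_def less_imp_le)
  then show ?thesis
    using k2_pos[OF Q \<epsilon>] by (simp add: observer_rate_def)
qed

lemma observer_error_dynamics:
  assumes kin: "attitude_kinematics \<omega> R" and obs: "attitude_observer A \<epsilon> \<omega> R Rh"
    and Rt0: "R 0 ** transpose (Rh 0) \<in> SO3" and t: "0 \<le> t"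
  defines "Q \<equiv> \<lambda>t. R t ** transpose (Rh t)"
  shows "Q t \<in> SO3"
    and "((\<lambda>t. (att_norm (Q t))\<^sup>2) has_real_derivative observer_rate A \<epsilon> (Q t)) (at t within {0..})"
proof -
  let ?s = "\<lambda>t. sigma_k2 A \<epsilon> (R t) (Rh t)"
  have D: "(Q has_vector_derivative Q t ** skew (?s t)) (at t within {0..})" if "t \<ge> 0" for t
    unfolding Q_def using kin obs that
    by (intro attitude_error_derivative) (auto simp: attitude_kinematics_def attitude_observer_def)
  have SO3: "Q t \<in> SO3" if "t \<ge> 0" for t
    using SO3_invariant[of Q ?s t] Rt0 D that by (simp add: Q_def)
  then show "Q t \<in> SO3"
    using t by simp
  have "psi (Q t) \<bullet> ?s t / 2 = observer_rate A \<epsilon> (Q t)"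
    by (simp add: sigma_k2_def observer_rate_def Q_def matrix_mul_assoc)
  then show "((\<lambda>t. (att_norm (Q t))\<^sup>2) has_real_derivative observer_rate A \<epsilon> (Q t)) (at t within {0..})"
    using att_norm_square_derivative[OF SO3 D[OF t] t] by simp
qed

theorem theorem2:
  fixes A :: "real^3^3" and \<epsilon> \<gamma> \<xi>\<^sub>0 :: real
  assumes "transpose A = A"
    and "pos_def (bar A)"
    and "\<epsilon> > 0" and "\<gamma> > 0"
    and "\<gamma> < (1 + \<epsilon>) powr (-1/2)"
    and "\<xi>\<^sub>0 = 1 - \<gamma>\<^sup>2 * \<epsilon> / (1 - \<gamma>\<^sup>2)"
  shows "class_KL (beta_lower A) \<and> class_KL (beta_upper \<gamma> A) \<and>
    (\<forall>(\<omega> :: real \<Rightarrow> real^3) (R :: real \<Rightarrow> real^3^3) (Rh :: real \<Rightarrow> real^3^3)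
       (Rt :: real \<Rightarrow> real^3^3).
       attitude_kinematics \<omega> R \<longrightarrow>
       attitude_observer A \<epsilon> \<omega> R Rh \<longrightarrow>
       (\<forall>t. Rt t = R t ** transpose (Rh t)) \<longrightarrow>
       Rt 0 \<in> att_ball \<xi>\<^sub>0 \<longrightarrow>
       (\<forall>t\<ge>0. beta_lower A (att_norm (Rt 0)) t \<le> att_norm (Rt t) \<and>
               att_norm (Rt t) \<le> beta_upper \<gamma> A (att_norm (Rt 0)) t))"
proof -
  let ?l = "lambda_min (bar A)" and ?u = "lambda_max (bar A)"
  have lu: "0 < ?l" "0 < ?u"
    using pos_def_lambda_bounds[OF assms(2)] by auto
  have lower: "beta_lower A = sech_flow ?u" and upper: "beta_upper \<gamma> A = sech_flow (\<gamma> * ?l)"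
    by (simp_all add: fun_eq_iff beta_lower_def beta_upper_def sech_flow_def)
  have "(1 + \<epsilon>) powr (-1/2) \<le> 1 powr (-1/2)"
    using assms(3) by (intro powr_mono2') auto
  then have \<gamma>: "\<gamma> < 1"
    using assms(5) by simp
  then have "\<gamma>\<^sup>2 < 1"
    using assms(4) by (simp add: power2_less_1_iff)
  then have \<xi>: "\<xi>\<^sub>0 < 1"
    using assms(3,4,6) by simp
  have bounds: "beta_lower A (att_norm (Rt 0)) t \<le> att_norm (Rt t) \<and>
      att_norm (Rt t) \<le> beta_upper \<gamma> A (att_norm (Rt 0)) t"
    if kin: "attitude_kinematics \<omega> R" and obs: "attitude_observer A \<epsilon> \<omega> R Rh"
      and Rt: "\<forall>t. Rt t = R t ** transpose (Rh t)" and ball: "Rt 0 \<in> att_ball \<xi>\<^sub>0" and t: "0 \<le> t"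
    for \<omega> R Rh Rt t
  proof -
    define V where "V t = (att_norm (Rt t))\<^sup>2" for t
    define V' where "V' t = observer_rate A \<epsilon> (Rt t)" for t
    have "R 0 ** transpose (Rh 0) \<in> SO3"
      using ball Rt by (simp add: att_ball_def)
    note dyn = observer_error_dynamics[OF kin obs this]
    have SO3: "Rt t \<in> SO3" if "t \<ge> 0" for t
      using dyn(1)[OF that] Rt by simp
    have D: "(V has_real_derivative V' t) (at t within {0..})" if "t \<ge> 0" for t
      using dyn(2)[OF that] Rt by (simp add: V_def[abs_def] V'_def)
    have norm: "att_norm (Rt t) = sqrt (V t)" if "t \<ge> 0" for t
      using att_norm_range(1)[OF SO3[OF that]] by (simp add: V_def)
    have "- V 0 \<le> - V t" if "t \<ge> 0" for t
    proof (rule nonneg_derivative_imp_initial_le[where f' = "\<lambda>t. - V' t", OF _ _ that])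
      show "((\<lambda>t. - V t) has_real_derivative - V' t) (at t within {0..})" if "t \<ge> 0" for t
        by (intro derivative_intros D that)
      show "0 \<le> - V' t" if "t \<ge> 0" for t
        using observer_rate_nonpos[OF SO3[OF that] assms(1,3,2)] by (simp add: V'_def)
    qed
    then have decr: "V t \<le> V 0" if "t \<ge> 0" for t
      using that by simp
    moreover have "V 0 < \<xi>\<^sub>0"
      using ball by (simp add: att_ball_def V_def)
    ultimately have V_less: "V t < \<xi>\<^sub>0" if "t \<ge> 0" for t
      using that by (meson le_less_trans)
    show ?thesis
    proof (cases "V 0 = 0")
      case True
      then have "V t = 0"
        using decr[OF t] by (simp add: V_def)
      with True show ?thesis
        using norm[OF t] norm[of 0] by (simp add: lower upper sech_flow_def)
    next
      case False
      have ge: "- 2 * ?u * V t * sqrt (1 - V t) \<le> V' t" if "t \<ge> 0" for t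
        using observer_rate_ge[OF SO3[OF that] assms(1,3)] lu by (simp add: V_def V'_def)
      have le: "V' t \<le> - 2 * (\<gamma> * ?l) * V t * sqrt (1 - V t)" if "t \<ge> 0" for t
        using observer_rate_le[OF SO3[OF that] assms(1,3) _ assms(4) \<gamma>] lu V_less[OF that] assms(6)
        by (simp add: V_def V'_def)
      have "0 < V t" if t: "t \<ge> 0" for t
      proof (rule positive_of_linear_decay_bound[OF D _ _ t])
        show "- (2 * ?u) * V t \<le> V' t" if "t \<ge> 0" for t
        proof -
          have "2 * ?u * V t * sqrt (1 - V t) \<le> 2 * ?u * V t * 1"
            using lu by (intro mult_left_mono) (auto simp: V_def)
          then show ?thesis
            using ge[OF that] by simp
        qed
        show "0 < V 0"
          using False by (simp add: V_def)
      qed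
      then have range: "0 < V t \<and> V t < 1" if "t \<ge> 0" for t
        using that V_less[OF that] \<xi> by simp
      show ?thesis
        using decay_rate_le_imp_ge_sech_flow[OF D range ge _ t]
          decay_rate_ge_imp_le_sech_flow[OF D range le _ t] lu assms(4) norm[OF t] norm[of 0]
        by (simp add: lower upper)
    qed
  qed
  show ?thesis
    using class_KL_sech_flow lu assms(4) bounds unfolding lower upper by (simp add: lower upper)
qed

end
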